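(* Let $r\ge 1$, let $a_1,\ldots,a_r>0$ be pairwise distinct, and let $C_{\vec n}$, $\vec n=(n_1,\ldots,n_r)\in\{0,1,2,\ldots\}^r$, be the multiple Charlier polynomials with parameters $(a_1,\ldots,a_r)$. Then for every multi-index $\vec n$, every $k\in\{1,\ldots,r\}$ and every $x$, $$x\,C_{\vec n}(x)=C_{\vec n+\vec e_k}(x)+(a_k+|\vec n|)\,C_{\vec n}(x)+\sum_{j=1}^r n_ja_j\,C_{\vec n-\vec e_j}(x),$$ where terms with $n_j=0$ in the last sum are understood to be $0$.
   Context: For pairwise distinct $a_1,\ldots,a_r>0$ and a multi-index $\vec n=(n_1,\ldots,n_r)$ of non-negative integers with size $|\vec n|=n_1+\cdots+n_r$, the multiple Charlier polynomial $C_{\vec n}$ with parameters $(a_1,\ldots,a_r)$ is the (unique) monic polynomial of degree $|\vec n|$ such that $$\sum_{k=0}^\infty C_{\vec n}(k)\,k^\ell\,\frac{a_j^k}{k!}=0,\qquad \ell=0,1,\ldots,n_j-1,\quad j=1,\ldots,r$$ (with $k^0=1$ for all $k$, including $k=0$). Here $\vec e_k=(0,\ldots,0,1,0,\ldots,0)$ is the $k$th unit vector in $\mathbb{N}^r$. *)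

theory Defs
  imports Complex_Main "HOL-Computational_Algebra.Polynomial"
begin

text \<open>
  Multi-indices with \<open>r\<close> entries and parameter vectors are functions on \<open>nat\<close> of which only
  the entries at \<open>1, \<dots>, r\<close> are ever inspected.
\<close>

definition mi_size :: "nat \<Rightarrow> (nat \<Rightarrow> nat) \<Rightarrow> nat" where
  "mi_size r n = (\<Sum>j=1..r. n j)"

text \<open>
  The orthogonality conditions are stated with \<open>sums\<close>, so convergence of the series is part of the
  definition. Note that \<open>0 ^ 0 = 1\<close> in HOL, as required for \<open>k = l = 0\<close>.
\<close>

definition is_multiple_charlier ::
    "nat \<Rightarrow> (nat \<Rightarrow> real) \<Rightarrow> (nat \<Rightarrow> nat) \<Rightarrow> real poly \<Rightarrow> bool" where
  "is_multiple_charlier r a n P \<longleftrightarrow>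
     degree P = mi_size r n \<and> lead_coeff P = 1 \<and>
     (\<forall>j\<in>{1..r}. \<forall>l<n j.
        (\<lambda>k. poly P (real k) * real k ^ l * (a j ^ k / fact k)) sums 0)"

definition multiple_charlier ::
    "nat \<Rightarrow> (nat \<Rightarrow> real) \<Rightarrow> (nat \<Rightarrow> nat) \<Rightarrow> real poly" where
  "multiple_charlier r a n = (THE P. is_multiple_charlier r a n P)"

end

theory Submission
  imports Defs
begin

text \<open>
  Identify a polynomial \<open>g\<close> in an auxiliary variable \<open>t\<close> with the polynomial \<open>umbral g\<close> in \<open>x\<close> by
  sending \<open>t ^ m\<close> to the falling factorial \<open>x (x - 1) \<dots> (x - m + 1)\<close>. Under this
  identification both ingredients of the definition of the multiple Charlier polynomials become
  elementary. Because \<open>\<Sum>k. k (k - 1) \<dots> (k - m + 1) b ^ k / k! = exp b * b ^ m\<close>, integrating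
  \<open>umbral g\<close> against the Poisson weight with parameter \<open>b\<close> is, up to the factor \<open>exp b\<close>, evaluation of
  \<open>g\<close> at \<open>b\<close> (\<open>umbral_sums\<close>). And because \<open>x\<close> times the \<open>m\<close>-th falling factorial is the
  \<open>(m + 1)\<close>-st one plus \<open>m\<close> times the \<open>m\<close>-th one, multiplication by \<open>x\<close> corresponds to the operator
  \<open>g \<mapsto> t * (g + g')\<close> (\<open>umbral_mult_x_operator\<close>).

  Hence the first \<open>n\<^sub>j\<close> moments of \<open>umbral g\<close> at the parameter \<open>a\<^sub>j \<noteq> 0\<close> vanish if and only
  if \<open>g\<close> vanishes at \<open>a\<^sub>j\<close> to order at least \<open>n\<^sub>j\<close> (\<open>umbral_orthogonal_iff\<close>). The parameters
  being distinct, a monic \<open>g\<close> of degree \<open>n\<^sub>1 + \<dots> + n\<^sub>r\<close> does this for all \<open>j\<close> precisely when it is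
  \<open>f\<^sub>n = (t - a\<^sub>1) ^ n\<^sub>1 \<dots> (t - a\<^sub>r) ^ n\<^sub>r\<close>. So the multiple Charlier polynomial exists, is unique,
  and equals \<open>umbral f\<^sub>n\<close> (\<open>multiple_charlier_eq_umbral\<close>).

  The recurrence is now the product rule. Writing \<open>t = (t - a\<^sub>j) + a\<^sub>j\<close> in each summand of
  \<open>t * f\<^sub>n'\<close> gives \<open>n\<^sub>j f\<^sub>n + n\<^sub>j a\<^sub>j f\<^bsub>n - e\<^sub>j\<^esub>\<close>, and writing \<open>t = (t - a\<^sub>k) + a\<^sub>k\<close> in \<open>t * f\<^sub>n\<close>
  gives \<open>f\<^bsub>n + e\<^sub>k\<^esub> + a\<^sub>k f\<^sub>n\<close>; the sum of all this is the image of \<open>x\<close> times the multiple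
  Charlier polynomial.
\<close>

section \<open>The umbral map to falling factorials\<close>

text \<open>
  This operator raises falling factorials: it sends the \<open>m\<close>-th one to the \<open>(m + 1)\<close>-st.
\<close>

definition falling_raise :: "real poly \<Rightarrow> real poly" where
  "falling_raise p = [:0, 1:] * pcompose p [:-1, 1:]"

text \<open>
  A Horner scheme in which \<open>falling_raise\<close> takes the place of multiplication by the variable, so that
  \<open>t ^ m\<close> is sent to the \<open>m\<close>-th falling factorial. In this form every property below follows by
  induction on the coefficient list, without manipulating falling factorials.
\<close>

definition umbral :: "real poly \<Rightarrow> real poly" where
  "umbral g = fold_coeffs (\<lambda>c p. [:c:] + falling_raise p) g 0"

definition mult_x_operator :: "real poly \<Rightarrow> real poly" where
  "mult_x_operator g = [:0, 1:] * (g + pderiv g)"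

lemma falling_raise_0 [simp]: "falling_raise 0 = 0"
  by (simp add: falling_raise_def)

lemma falling_raise_add: "falling_raise (p + q) = falling_raise p + falling_raise q"
  by (simp add: falling_raise_def pcompose_add algebra_simps)

lemma falling_raise_smult: "falling_raise (smult c p) = smult c (falling_raise p)"
  by (simp add: falling_raise_def pcompose_smult)

lemma poly_falling_raise: "poly (falling_raise p) x = x * poly p (x - 1)"
  by (simp add: falling_raise_def poly_pcompose)

lemma degree_lead_coeff_falling_raise:
  assumes "p \<noteq> 0"
  shows "degree (falling_raise p) = Suc (degree p)"
    and "lead_coeff (falling_raise p) = lead_coeff p"
proof -
  have q: "pcompose p [:-1, 1:] \<noteq> 0"
    using assms by (simp add: pcompose_eq_0_iff)
  show "degree (falling_raise p) = Suc (degree p)"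
    unfolding falling_raise_def using q by (subst degree_mult_eq) (auto simp: degree_pcompose)
  show "lead_coeff (falling_raise p) = lead_coeff p"
    unfolding falling_raise_def by (simp only: lead_coeff_mult) (simp add: lead_coeff_comp)
qed

text \<open>
  Both sides are \<open>x\<close> times a shift by one, and the second factor \<open>x\<close> is \<open>(x - 1) + 1\<close>: moving
  multiplication by \<open>x\<close> under the shift costs one extra copy of \<open>p\<close>.
\<close>

lemma mult_x_falling_raise: "[:0, 1:] * falling_raise p = falling_raise ([:0, 1:] * p + p)"
  by (simp add: falling_raise_def pcompose_add pcompose_mult pcompose_pCons algebra_simps)

lemma umbral_0 [simp]: "umbral 0 = 0"
  by (simp add: umbral_def)

lemma umbral_pCons: "umbral (pCons c g) = [:c:] + falling_raise (umbral g)"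
  by (cases "c = 0 \<and> g = 0") (auto simp: umbral_def)

lemma umbral_const: "umbral [:c:] = [:c:]"
  by (simp add: umbral_pCons)

lemma umbral_add: "umbral (g + h) = umbral g + umbral h"
  by (induction g h rule: poly_induct2) (simp_all add: umbral_pCons falling_raise_add)

lemma umbral_smult: "umbral (smult c g) = smult c (umbral g)"
  by (induction g) (simp_all add: umbral_pCons falling_raise_smult smult_add_right)

lemma umbral_sum: "umbral (\<Sum>i\<in>A. g i) = (\<Sum>i\<in>A. umbral (g i))"
  by (induction A rule: infinite_finite_induct) (simp_all add: umbral_add)

lemma degree_umbral: "degree (umbral g) = degree g"
  and lead_coeff_umbral: "coeff (umbral g) (degree g) = lead_coeff g"
proof -
  have "degree (umbral g) = degree g \<and> coeff (umbral g) (degree g) = lead_coeff g"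
  proof (induction g)
    case (pCons c g)
    show ?case
    proof (cases "g = 0")
      case False
      then have "umbral g \<noteq> 0"
        using pCons.IH by (metis coeff_0 leading_coeff_neq_0)
      from degree_lead_coeff_falling_raise[OF this] pCons.IH
      have raise: "degree (falling_raise (umbral g)) = Suc (degree g)"
          "coeff (falling_raise (umbral g)) (Suc (degree g)) = lead_coeff g"
        by auto
      then have "degree (umbral (pCons c g)) = Suc (degree g)"
        unfolding umbral_pCons by (subst degree_add_eq_right) simp_all
      then show ?thesis
        using raise False by (simp add: umbral_pCons coeff_pCons)
    qed (simp add: umbral_pCons)
  qed simp
  then show "degree (umbral g) = degree g" and "coeff (umbral g) (degree g) = lead_coeff g"
    by auto
qed

text \<open>
  Inductively, multiplication by \<open>x\<close> passes through each \<open>falling_raise\<close> of the Horner scheme at the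
  cost of one extra summand; these extra summands add up to \<open>t * g'\<close>.
\<close>

lemma umbral_mult_x_operator: "umbral (mult_x_operator g) = [:0, 1:] * umbral g"
proof (induction g)
  case (pCons c g)
  have "mult_x_operator (pCons c g) = [:0, c:] + pCons 0 (mult_x_operator g + g)"
    by (simp add: mult_x_operator_def pderiv_pCons algebra_simps)
  then have "umbral (mult_x_operator (pCons c g))
      = umbral [:0, c:] + falling_raise (umbral (mult_x_operator g) + umbral g)"
    by (simp only: umbral_add umbral_pCons) (simp add: umbral_add)
  also have "\<dots> = [:0, c:] + [:0, 1:] * falling_raise (umbral g)"
    by (simp only: pCons.IH mult_x_falling_raise)
       (simp add: umbral_pCons falling_raise_def pcompose_pCons)
  also have "\<dots> = [:0, 1:] * umbral (pCons c g)"
    by (simp add: umbral_pCons algebra_simps)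
  finally show ?case .
qed (simp add: mult_x_operator_def)

lemma umbral_mult_x_operator_power:
  "umbral ((mult_x_operator ^^ l) g) = [:0, 1:] ^ l * umbral g"
  by (induction l) (simp_all only: funpow.simps o_apply id_apply umbral_mult_x_operator
      power_Suc mult.assoc power_0 mult_1_left)

text \<open>
  The image contains the constants and is closed under multiplication by \<open>x\<close>, hence is everything.
\<close>

lemma umbral_surj: "\<exists>g. umbral g = p"
proof (induction p)
  case (pCons c p)
  then obtain g where "umbral g = p"
    by blast
  then have "umbral ([:c:] + mult_x_operator g) = pCons c p"
    by (simp only: umbral_add umbral_const umbral_mult_x_operator) simp
  then show ?case ..
qed (auto intro: exI[of _ 0])

section \<open>Poisson moments in umbral form\<close>

text \<open>
  The \<open>k = 0\<close> term of the left-hand side vanishes, and \<open>k / k! = 1 / (k - 1)!\<close> for the others.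
\<close>

lemma falling_raise_sums:
  assumes "(\<lambda>k. poly p (real k) * (b ^ k / fact k)) sums s"
  shows "(\<lambda>k. poly (falling_raise p) (real k) * (b ^ k / fact k)) sums (b * s)"
proof -
  have "poly (falling_raise p) (real (Suc k)) * (b ^ Suc k / fact (Suc k))
      = b * (poly p (real k) * (b ^ k / fact k))" for k
  proof -
    have "real (Suc k) - 1 = real k"
      by simp
    then show ?thesis
      by (simp only: poly_falling_raise) (simp add: field_simps del: of_nat_Suc)
  qed
  then have "(\<lambda>k. poly (falling_raise p) (real (Suc k)) * (b ^ Suc k / fact (Suc k))) sums (b * s)"
    using sums_mult[OF assms, of b] by simp
  then show ?thesis
    by (subst (asm) sums_Suc_iff) (simp add: poly_falling_raise)
qed

lemma umbral_sums:
  "(\<lambda>k. poly (umbral g) (real k) * (b ^ k / fact k)) sums (exp b * poly g b)"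
proof (induction g)
  case (pCons c g)
  have "(\<lambda>k. c * (b ^ k / fact k)) sums (c * exp b)"
    using sums_mult[OF exp_converges[of b], of c] by (simp add: divide_inverse_commute)
  from sums_add[OF this falling_raise_sums[OF pCons.IH]] show ?case
    by (simp add: umbral_pCons algebra_simps add_divide_distrib)
qed simp

lemma umbral_moment_sums:
  "(\<lambda>k. poly (umbral g) (real k) * real k ^ l * (b ^ k / fact k))
     sums (exp b * poly ((mult_x_operator ^^ l) g) b)"
  using umbral_sums[of "(mult_x_operator ^^ l) g" b]
  by (simp add: umbral_mult_x_operator_power poly_power mult.commute mult.left_commute)

section \<open>Vanishing moments and multiplicities of roots\<close>

lemma pderiv_linear_power:
  fixes b :: real
  shows "pderiv ([:-b, 1:] ^ Suc m) = smult (real (Suc m)) ([:-b, 1:] ^ m)"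
  by (simp only: pderiv_power_Suc) (simp add: pderiv_pCons)

text \<open>
  Differentiation lowers the multiplicity of the root \<open>b\<close> by exactly one, whereas multiplication by
  \<open>t\<close> does not change it because \<open>b \<noteq> 0\<close>.
\<close>

lemma power_dvd_Suc_iff_mult_x_operator:
  assumes "b \<noteq> 0"
  shows "[:-b, 1:] ^ Suc m dvd g \<longleftrightarrow> poly g b = 0 \<and> [:-b, 1:] ^ m dvd mult_x_operator g"
proof (cases "g = 0 \<or> poly g b \<noteq> 0")
  case True
  then show ?thesis
    by (auto simp: mult_x_operator_def dvd_def)
next
  case False
  then have g: "g \<noteq> 0" and root: "poly g b = 0"
    by auto
  obtain h where h: "g = [:-b, 1:] ^ order b g * h" "\<not> [:-b, 1:] dvd h"
    using order_decomp[OF g] by blast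
  obtain i where i: "order b g = Suc i"
    using root g by (metis order_root not0_implies_Suc)
  \<comment> \<open>the cofactor of \<open>mult_x_operator g\<close>, with value \<open>b * (i + 1) * h(b) \<noteq> 0\<close> at \<open>b\<close>\<close>
  define q where "q = [:0, 1:] * ([:-b, 1:] * (h + pderiv h) + smult (real (Suc i)) h)"
  define X where "X = [:-b, 1:]"
  have X: "pderiv (X ^ Suc i) = smult (real (Suc i)) (X ^ i)"
    by (simp only: X_def pderiv_linear_power)
  have gX: "g = X ^ Suc i * h"
    using h(1) by (simp only: i X_def)
  have "g + pderiv g = X ^ i * (X * (h + pderiv h) + smult (real (Suc i)) h)"
    by (simp only: gX pderiv_mult X) (simp add: algebra_simps)
  then have "mult_x_operator g = [:-b, 1:] ^ i * q"
    by (simp only: mult_x_operator_def q_def X_def mult.left_commute)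
  moreover have q: "poly q b \<noteq> 0"
    using h(2) assms by (simp add: q_def poly_eq_0_iff_dvd)
  then have nz: "[:-b, 1:] ^ i * q \<noteq> 0"
    by auto
  moreover have "order b ([:-b, 1:] ^ i * q) = i"
    using order_mult[OF nz] order_power_n_n[of b i] order_0I[OF q] by simp
  ultimately have "[:-b, 1:] ^ m dvd mult_x_operator g \<longleftrightarrow> m \<le> i"
    by (simp add: order_divides)
  then show ?thesis
    using root g i by (auto simp: order_divides simp del: power_Suc)
qed

text \<open>
  Iterating the preceding equivalence: each further condition raises the guaranteed multiplicity
  by one.
\<close>

lemma mult_x_operator_vanish_iff:
  assumes "b \<noteq> 0"
  shows "(\<forall>l<m. poly ((mult_x_operator ^^ l) g) b = 0) \<longleftrightarrow> [:-b, 1:] ^ m dvd g"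
proof (induction m arbitrary: g)
  case (Suc m)
  have "(\<forall>l<Suc m. poly ((mult_x_operator ^^ l) g) b = 0)
      \<longleftrightarrow> poly g b = 0 \<and> (\<forall>l<m. poly ((mult_x_operator ^^ l) (mult_x_operator g)) b = 0)"
    by (simp add: All_less_Suc2 funpow_Suc_right del: funpow.simps(2))
  then show ?case
    by (simp only: Suc.IH power_dvd_Suc_iff_mult_x_operator[OF assms])
qed simp

lemma umbral_orthogonal_iff:
  assumes "b \<noteq> 0"
  shows "(\<forall>l<m. (\<lambda>k. poly (umbral g) (real k) * real k ^ l * (b ^ k / fact k)) sums 0)
     \<longleftrightarrow> [:-b, 1:] ^ m dvd g"
proof -
  have "(\<lambda>k. poly (umbral g) (real k) * real k ^ l * (b ^ k / fact k)) sums 0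
      \<longleftrightarrow> poly ((mult_x_operator ^^ l) g) b = 0" for l
    using umbral_moment_sums[of g l b] sums_unique2 by fastforce
  then show ?thesis
    by (simp only: mult_x_operator_vanish_iff[OF assms])
qed

section \<open>The umbral preimage of a multiple Charlier polynomial\<close>

definition charlier_symbol :: "nat \<Rightarrow> (nat \<Rightarrow> real) \<Rightarrow> (nat \<Rightarrow> nat) \<Rightarrow> real poly" where
  "charlier_symbol r a n = (\<Prod>j=1..r. [:- a j, 1:] ^ n j)"

lemma charlier_symbol_remove:
  assumes "j \<in> {1..r}"
  shows "charlier_symbol r a (n(j := m)) = [:- a j, 1:] ^ m * (\<Prod>i\<in>{1..r} - {j}. [:- a i, 1:] ^ n i)"
  unfolding charlier_symbol_def using assms
  by (subst prod.remove[of _ j]) (auto intro!: prod.cong)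

lemma degree_charlier_symbol: "degree (charlier_symbol r a n) = mi_size r n"
  by (simp add: charlier_symbol_def mi_size_def degree_prod_eq_sum_degree degree_linear_power)

lemma lead_coeff_charlier_symbol: "lead_coeff (charlier_symbol r a n) = 1"
  by (simp only: charlier_symbol_def lead_coeff_prod lead_coeff_power) simp

lemma charlier_symbol_neq_0: "charlier_symbol r a n \<noteq> 0"
  using lead_coeff_charlier_symbol[of r a n] by auto

text \<open>
  A product over \<open>J\<close> that divides \<open>g\<close> does not vanish at a further point \<open>a i\<close>, so the cofactor
  inherits the whole multiplicity of \<open>g\<close> at \<open>a i\<close>.
\<close>

lemma prod_linear_power_dvd:
  fixes a :: "'b \<Rightarrow> 'a :: field"
  assumes "finite J" and "inj_on a J" and "\<And>j. j \<in> J \<Longrightarrow> [:- a j, 1:] ^ n j dvd g"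
  shows "(\<Prod>j\<in>J. [:- a j, 1:] ^ n j) dvd g"
  using assms
proof (induction J rule: finite_induct)
  case (insert i J)
  define f where "f = (\<Prod>j\<in>J. [:- a j, 1:] ^ n j)"
  obtain h where h: "g = f * h"
    using insert unfolding f_def by (auto elim: dvdE)
  have "poly f (a i) \<noteq> 0"
    using insert.hyps insert.prems(1) by (auto simp: f_def poly_prod poly_power)
  then have "f \<noteq> 0" and "order (a i) g = order (a i) h" if "g \<noteq> 0"
    using that h by (auto simp: order_mult order_0I)
  then have "[:- a i, 1:] ^ n i dvd h"
    using insert.prems(2)[of i] h \<open>poly f (a i) \<noteq> 0\<close> by (cases "g = 0") (auto simp: order_divides)
  then show ?case
    using insert.hyps by (simp add: h f_def[symmetric] mult.commute mult_dvd_mono)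
qed simp

lemma is_multiple_charlier_umbral_iff:
  assumes "\<forall>j\<in>{1..r}. a j > 0" and "inj_on a {1..r}"
  shows "is_multiple_charlier r a n (umbral g) \<longleftrightarrow> g = charlier_symbol r a n"
proof -
  let ?f = "charlier_symbol r a n"
  have "a j \<noteq> 0" if "j \<in> {1..r}" for j
    using assms(1) that by force
  then have "(\<forall>j\<in>{1..r}. \<forall>l<n j.
        (\<lambda>k. poly (umbral g) (real k) * real k ^ l * (a j ^ k / fact k)) sums 0)
      \<longleftrightarrow> (\<forall>j\<in>{1..r}. [:- a j, 1:] ^ n j dvd g)"
    by (intro ball_cong refl umbral_orthogonal_iff)
  also have "\<dots> \<longleftrightarrow> ?f dvd g"
  proof
    assume "\<forall>j\<in>{1..r}. [:- a j, 1:] ^ n j dvd g"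
    then show "?f dvd g"
      unfolding charlier_symbol_def using assms(2) by (intro prod_linear_power_dvd) auto
  next
    assume "?f dvd g"
    moreover have "[:- a j, 1:] ^ n j dvd ?f" if "j \<in> {1..r}" for j
      unfolding charlier_symbol_def using that by (intro dvd_prodI) auto
    ultimately show "\<forall>j\<in>{1..r}. [:- a j, 1:] ^ n j dvd g"
      by (meson dvd_trans)
  qed
  finally have "is_multiple_charlier r a n (umbral g)
      \<longleftrightarrow> degree g = degree ?f \<and> lead_coeff g = 1 \<and> ?f dvd g"
    unfolding is_multiple_charlier_def
    by (simp only: degree_umbral lead_coeff_umbral degree_charlier_symbol conj_assoc)
  also have "\<dots> \<longleftrightarrow> g = ?f"
  proof
    assume g: "degree g = degree ?f \<and> lead_coeff g = 1 \<and> ?f dvd g"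
    then obtain h where h: "g = ?f * h" by (auto elim: dvdE)
    have "h \<noteq> 0" using g h by auto
    then have "degree h = 0"
      using g h charlier_symbol_neq_0[of r a n] by (simp add: degree_mult_eq)
    moreover have "lead_coeff h = 1"
      using g h by (simp only: lead_coeff_mult lead_coeff_charlier_symbol mult_1_left)
    ultimately have "h = 1" by (auto elim: degree_eq_zeroE)
    then show "g = ?f" using h by simp
  qed (use lead_coeff_charlier_symbol in auto)
  finally show ?thesis .
qed

lemma multiple_charlier_eq_umbral:
  assumes "\<forall>j\<in>{1..r}. a j > 0" and "inj_on a {1..r}"
  shows "multiple_charlier r a n = umbral (charlier_symbol r a n)"
  unfolding multiple_charlier_def
proof (rule the_equality)
  show "is_multiple_charlier r a n (umbral (charlier_symbol r a n))"
    by (simp add: is_multiple_charlier_umbral_iff[OF assms])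
next
  fix p assume p: "is_multiple_charlier r a n p"
  obtain g where "umbral g = p"
    using umbral_surj by blast
  with p show "p = umbral (charlier_symbol r a n)"
    using is_multiple_charlier_umbral_iff[OF assms, of n g] by simp
qed

section \<open>The recurrence relation\<close>

lemma mult_x_pderiv_charlier_symbol:
  "[:0, 1:] * pderiv (charlier_symbol r a n) = smult (real (mi_size r n)) (charlier_symbol r a n)
     + (\<Sum>j=1..r. smult (real (n j) * a j) (charlier_symbol r a (n(j := n j - 1))))"
proof -
  let ?f = "charlier_symbol r a"
  have summand: "[:0, 1:] * ((\<Prod>i\<in>{1..r} - {j}. [:- a i, 1:] ^ n i) * pderiv ([:- a j, 1:] ^ n j))
      = smult (real (n j)) (?f n) + smult (real (n j) * a j) (?f (n(j := n j - 1)))"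
    if j: "j \<in> {1..r}" for j
  proof (cases "n j")
    case (Suc m)
    let ?R = "\<Prod>i\<in>{1..r} - {j}. [:- a i, 1:] ^ n i"
    have f: "?f n = [:- a j, 1:] * ([:- a j, 1:] ^ m * ?R)"
      using charlier_symbol_remove[OF j, of a n "n j", unfolded fun_upd_triv]
      by (simp only: Suc power_Suc mult.assoc)
    have f': "?f (n(j := n j - 1)) = [:- a j, 1:] ^ m * ?R"
      using charlier_symbol_remove[OF j, of a n m] Suc by simp
    have "[:0, 1:] * (?R * pderiv ([:- a j, 1:] ^ n j))
        = smult (real (n j)) ([:0, 1:] * ([:- a j, 1:] ^ m * ?R))"
      by (simp only: Suc pderiv_linear_power mult_smult_left mult_smult_right mult.commute)
    also have "\<dots> = smult (real (n j)) (([:- a j, 1:] + [:a j:]) * ([:- a j, 1:] ^ m * ?R))"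
      by simp
    also have "\<dots> = smult (real (n j)) (?f n) + smult (real (n j) * a j) (?f (n(j := n j - 1)))"
      unfolding f f' by (simp only: distrib_right smult_add_right) simp
    finally show ?thesis .
  qed simp
  have "[:0, 1:] * pderiv (?f n)
      = (\<Sum>j=1..r. smult (real (n j)) (?f n) + smult (real (n j) * a j) (?f (n(j := n j - 1))))"
    unfolding charlier_symbol_def[of r a n] pderiv_prod sum_distrib_left
    by (intro sum.cong refl) (simp only: summand charlier_symbol_def[of r a n, symmetric])
  then show ?thesis
    by (simp add: sum.distrib mi_size_def smult_sum)
qed

theorem theorem2p2:
  fixes r :: nat and a :: "nat \<Rightarrow> real" and n :: "nat \<Rightarrow> nat" and k :: nat and x :: real
  assumes "r \<ge> 1"
    and "\<forall>j\<in>{1..r}. a j > 0"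
    and "inj_on a {1..r}"
    and "k \<in> {1..r}"
  shows "x * poly (multiple_charlier r a n) x =
           poly (multiple_charlier r a (n(k := n k + 1))) x
           + (a k + real (mi_size r n)) * poly (multiple_charlier r a n) x
           + (\<Sum>j=1..r. real (n j) * a j * poly (multiple_charlier r a (n(j := n j - 1))) x)"
proof -
  let ?f = "charlier_symbol r a"
  have "?f (n(k := n k + 1)) = [:- a k, 1:] * ?f n"
    using charlier_symbol_remove[OF assms(4), of a n "n k + 1"]
      charlier_symbol_remove[OF assms(4), of a n "n k"]
    by (simp only: fun_upd_triv power_add power_one_right mult.assoc mult.commute mult.left_commute)
  then have "[:0, 1:] * ?f n = ?f (n(k := n k + 1)) + smult (a k) (?f n)"
    by simp
  then have "mult_x_operator (?f n) = ?f (n(k := n k + 1)) + smult (a k + real (mi_size r n)) (?f n)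
      + (\<Sum>j=1..r. smult (real (n j) * a j) (?f (n(j := n j - 1))))"
    unfolding mult_x_operator_def distrib_left mult_x_pderiv_charlier_symbol
    by (simp only: smult_add_left add.assoc)
  from arg_cong[OF this, of "\<lambda>g. poly (umbral g) x"] show ?thesis
    by (simp add: umbral_mult_x_operator umbral_add umbral_smult umbral_sum poly_sum
        multiple_charlier_eq_umbral[OF assms(2,3)])
qed

end
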